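(* For each version index $j\ge0$, suppose that at most one candidate is selected while $\psi_j$ is active and that, whenever selection occurs, the certification setting described in the context (recurrence of the enabled samples, and aggregate/core error allocations fixed at selection time with total at most $\delta_j$) holds with error budget $\delta_j$. Suppose also that each $\delta_j\in(0,1)$ is fixed no later than selection time (it is deterministic or $\mathcal H_j$-measurable) and that $\sum_{j=0}^\infty\delta_j\le\delta$ almost surely for some $\delta\in(0,1)$. Then $$\Pr\Bigl(\bigcup_{j=0}^\infty F_j\Bigr)\le\delta .$$
   Context: Timed streams. Let $\mathcal{AP}$ be a finite set of atomic propositions. An infinite timed stream is $\mathbf e=e_0e_1\cdots$ with $e_n=(t_n,\nu_n)$, $t_n\in\mathbb R_{\ge0}$, $\nu_n\subseteq\mathcal{AP}$, $t_n\le t_{n+1}$, $\lim_n t_n=\infty$. $\mathbf e_{\le n}=e_0\cdots e_n$. Here $\mathbf e$ is a random timed stream on a probability space $(\Omega,\mathcal F,\mathbb P)$, and all random objects below are measurable. Formulas. $\Phi$ is generated by $\varphi::=p\mid\top\mid\bot\mid\neg\varphi\mid\varphi\land\varphi\mid\varphi\lor\varphi\mid\Box_{[a,b]}\varphi\mid\Diamond_{[a,b]}\varphi$, $p\in\mathcal{AP}$, $0\le a\le b<\infty$, with satisfaction: $\mathbf e,n\models p$ iff $p\in\nu_n$; $\top$ always, $\bot$ never; Boolean connectives as usual; $\Box_{[a,b]}\varphi$ (resp. $\Diamond_{[a,b]}\varphi$) holds at $n$ iff $\varphi$ holds at all (resp. some) $m\ge n$ with $t_m-t_n\in[a,b]$.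 Horizon: $0$ for atoms and constants; unchanged by $\neg$; maximum for $\land,\lor$; $\operatorname{hzn}(\Box_{[a,b]}\varphi)=\operatorname{hzn}(\Diamond_{[a,b]}\varphi)=b+\operatorname{hzn}(\varphi)$. Specifications. A specification is a tuple $\psi=(\varphi_1^{\mathrm{core}},\varphi_1^{\mathrm{adapt}},\varphi_2^{\mathrm{core}},\varphi_2^{\mathrm{adapt}},\lambda,a,b)$ with formulas in $\Phi$ and $(\lambda,a,b)$ in a fixed measurable envelope $\mathcal A_{\mathrm{par}}\subseteq\{(\lambda,a,b)\in[0,1]\times\mathbb R_{\ge0}^2:a\le b<\infty\}$; $\Psi$ is the (measurable) space of specifications. $\operatorname{trig}(\psi)=\varphi_1^{\mathrm{core}}\lor\varphi_1^{\mathrm{adapt}}$, $\operatorname{resp}(\psi)=\varphi_2^{\mathrm{core}}\land\varphi_2^{\mathrm{adapt}}$, $H(\psi)=\max\{\operatorname{hzn}(\operatorname{trig}(\psi)),b+\operatorname{hzn}(\operatorname{resp}(\psi))\}$, $X_k^\psi=\mathbf 1[\exists m\ge k:t_m-t_k\in[a,b]\land\mathbf e,m\models\operatorname{resp}(\psi)]$. A relation $\mathcal R\subseteq\Psi\times\Psi$ of admissible revisions is fixed such that $\psi\mathrel{\mathcal R}\widetilde\psi$ implies: equal protected ("core") components, at most one differing adaptive component, parameters of $\widetilde\psi$ in $\mathcal A_{\mathrm{par}}$, and at least one adaptive component or the parameter tuple differs. A threshold $\lambda_{\mathrm{core}}\in[0,1]$ is fixed by the designer in advance. Selection. The run starts with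 $\psi_0$ active from $n_0=0$. While $\psi_j$ is active, at most one candidate is selected, at random index $n_j^\star\in\mathbb N\cup\{\infty\}$ with $n_j^\star\ge n_j$ ($\infty$ if none is selected or version $j$ is never reached). On $\{n_j^\star<\infty\}$, $\mathcal P_{n_j^\star,j}\subseteq\Psi$ is the set of candidates proposed by an arbitrary, possibly randomized, proposer, $\psi_j^\star\in\mathcal P_{n_j^\star,j}$ is the selected candidate, with $\psi_j\mathrel{\mathcal R}\psi_j^\star$, and $\xi_j$ collects all internal randomness used up to selection; on $\{n_j^\star=\infty\}$ these and the stopped prefix take fixed cemetery values. $\mathcal H_j=\sigma(\mathbf 1_{\{n_j^\star<\infty\}},n_j^\star,\mathbf e_{\le n_j^\star},\mathcal P_{n_j^\star,j},\psi_j^\star,\xi_j)$. What follows is on $\{n_j^\star<\infty\}$, with dependence on $j$ suppressed: $n^\star,\psi^\star$, $\lambda^\star$ (threshold of $\psi^\star$), $H^\star=H(\psi^\star)$, $X_k=X_k^{\psi^\star}$, $\varphi_1^{\mathrm{core}}$ the protected trigger of $\psi^\star$. Samples. Group $g=\mathrm{all}$ is always enabled; $g=\mathrm{core}$ is enabled iff $\varphi_1^{\mathrm{core}}\ne\bot$. For $m>n^\star$, $K_m^{(\mathrm{all})}=\{k>n^\star:\mathbf e,k\models\operatorname{trig}(\psi^\star),\ t_m>t_k+H^\star\}$, $K_m^{(\mathrm{core})}=\{k\in K_m^{(\mathrm{all})}:\mathbf e,k\models\varphi_1^{\mathrm{core}}\}$, $N_m^{(g)}=|K_m^{(g)}|$.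 Recurrence: for every enabled $g$, $\bigcup_{m>n^\star}K_m^{(g)}$ is almost surely infinite; enumerate it increasingly as $k_1^{(g)}<k_2^{(g)}<\cdots$. Let $\tau_s^{(g)}=\min\{m>n^\star:N_m^{(g)}\ge s\}$, $\mathcal G_{j,0}^{(g)}=\mathcal H_j$, $\mathcal G_{j,s}^{(g)}=\sigma(\mathcal H_j,(k_r^{(g)},\tau_r^{(g)},X_{k_r^{(g)}})_{r=1}^s)$. Statistics. $p_s^{(g)}=\Pr(X_{k_s^{(g)}}=1\mid\mathcal G_{j,s-1}^{(g)})$, $\bar p_q^{(g)}=\frac1q\sum_{s=1}^qp_s^{(g)}$, $\widehat p_q^{(g)}=\frac1q\sum_{s=1}^qX_{k_s^{(g)}}$. Allocations $\delta_j^{\mathrm{all}}>0$, $\delta_j^{\mathrm{core}}\ge0$ are $\mathcal H_j$-measurable with $\delta_j^{\mathrm{all}}+\delta_j^{\mathrm{core}}\le\delta_j$; $\delta_j^{\mathrm{core}}>0$ if core is enabled and $=0$ otherwise. $\delta_{j,q}^{(g)}=6\delta_j^{(g)}/(\pi^2q^2)$. For $q=N_m^{(g)}>0$, $L_m^{(g)}=\max\{0,\ \widehat p_q^{(g)}-\sqrt{\log(1/\delta_{j,q}^{(g)})/(2q)}\}$; $L_m^{(g)}=0$ if $N_m^{(g)}=0$. Activation. $m_j^{\mathrm{cert}}$ is the least $m>n^\star$ with $N_m^{(\mathrm{all})}>0$, $L_m^{(\mathrm{all})}\ge\lambda^\star$ and, if core is enabled, $N_m^{(\mathrm{core})}>0$,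 $L_m^{(\mathrm{core})}\ge\lambda_{\mathrm{core}}$ ($\infty$ if no such $m$, or if $n_j^\star=\infty$). The candidate is activated iff $m_j^{\mathrm{cert}}<\infty$, and then $\psi_{j+1}=\psi_j^\star$, $n_{j+1}=m_j^{\mathrm{cert}}+1$; otherwise there is no further version and $n_{j+1}=\infty$. Failure events. $F_j^{\mathrm{all}}=\{\psi_j^\star\text{ is activated and }\bar p^{(\mathrm{all})}_{q}<\lambda^\star\text{ for }q=N^{(\mathrm{all})}_{n_{j+1}-1}\}$; if core is enabled, $F_j^{\mathrm{core}}=\{\psi_j^\star\text{ is activated and }\bar p^{(\mathrm{core})}_{q}<\lambda_{\mathrm{core}}\text{ for }q=N^{(\mathrm{core})}_{n_{j+1}-1}\}$, otherwise $F_j^{\mathrm{core}}=\varnothing$. $F_j=F_j^{\mathrm{all}}\cup F_j^{\mathrm{core}}$, and no outcome belongs to $F_j$ if $\psi_j$ is not reached or no successor is activated. *)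

theory Defs
  imports "HOL-Probability.Probability"
begin

type_synonym 'ap event = "real \<times> 'ap set"
type_synonym 'ap tstream = "nat \<Rightarrow> 'ap event"

definition timed_stream :: "'ap tstream \<Rightarrow> bool" where
  "timed_stream e \<longleftrightarrow>
     (\<forall>n. 0 \<le> fst (e n)) \<and> (\<forall>n. fst (e n) \<le> fst (e (Suc n))) \<and>
     filterlim (\<lambda>n. fst (e n)) at_top sequentially"

datatype 'ap formula =
    Atom 'ap
  | Top
  | Bot
  | Neg "'ap formula"
  | And "'ap formula" "'ap formula"
  | Or "'ap formula" "'ap formula"
  | Box real real "'ap formula"
  | Dia real real "'ap formula"

text \<open>The datatype allows arbitrary real interval bounds; \<open>wf_formula\<close> carves out \<open>\<Phi>\<close>.\<close>

primrec wf_formula :: "'ap formula \<Rightarrow> bool" where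
  "wf_formula (Atom p) = True"
| "wf_formula Top = True"
| "wf_formula Bot = True"
| "wf_formula (Neg f) = wf_formula f"
| "wf_formula (And f g) = (wf_formula f \<and> wf_formula g)"
| "wf_formula (Or f g) = (wf_formula f \<and> wf_formula g)"
| "wf_formula (Box a b f) = (0 \<le> a \<and> a \<le> b \<and> wf_formula f)"
| "wf_formula (Dia a b f) = (0 \<le> a \<and> a \<le> b \<and> wf_formula f)"

primrec sat :: "'ap tstream \<Rightarrow> nat \<Rightarrow> 'ap formula \<Rightarrow> bool" where
  "sat e n (Atom p) = (p \<in> snd (e n))"
| "sat e n Top = True"
| "sat e n Bot = False"
| "sat e n (Neg f) = (\<not> sat e n f)"
| "sat e n (And f g) = (sat e n f \<and> sat e n g)"
| "sat e n (Or f g) = (sat e n f \<or> sat e n g)"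
| "sat e n (Box a b f) = (\<forall>m\<ge>n. fst (e m) - fst (e n) \<in> {a..b} \<longrightarrow> sat e m f)"
| "sat e n (Dia a b f) = (\<exists>m\<ge>n. fst (e m) - fst (e n) \<in> {a..b} \<and> sat e m f)"

primrec hzn :: "'ap formula \<Rightarrow> real" where
  "hzn (Atom p) = 0"
| "hzn Top = 0"
| "hzn Bot = 0"
| "hzn (Neg f) = hzn f"
| "hzn (And f g) = max (hzn f) (hzn g)"
| "hzn (Or f g) = max (hzn f) (hzn g)"
| "hzn (Box a b f) = b + hzn f"
| "hzn (Dia a b f) = b + hzn f"

datatype 'ap spec =
  Spec (trig_core: "'ap formula") (trig_adapt: "'ap formula")
       (resp_core: "'ap formula") (resp_adapt: "'ap formula")
       (thr: real) (lo: real) (hi: real)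

definition params :: "'ap spec \<Rightarrow> real \<times> real \<times> real" where
  "params \<psi> = (thr \<psi>, lo \<psi>, hi \<psi>)"

definition trig :: "'ap spec \<Rightarrow> 'ap formula" where
  "trig \<psi> = Or (trig_core \<psi>) (trig_adapt \<psi>)"

definition resp :: "'ap spec \<Rightarrow> 'ap formula" where
  "resp \<psi> = And (resp_core \<psi>) (resp_adapt \<psi>)"

definition spec_horizon :: "'ap spec \<Rightarrow> real" where
  "spec_horizon \<psi> = max (hzn (trig \<psi>)) (hi \<psi> + hzn (resp \<psi>))"

definition responds :: "'ap tstream \<Rightarrow> 'ap spec \<Rightarrow> nat \<Rightarrow> bool" where
  "responds e \<psi> k \<longleftrightarrow>
     (\<exists>m\<ge>k. fst (e m) - fst (e k) \<in> {lo \<psi>..hi \<psi>} \<and> sat e m (resp \<psi>))"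

definition spec_set :: "(real \<times> real \<times> real) set \<Rightarrow> 'ap spec set" where
  "spec_set A = {\<psi>. wf_formula (trig_core \<psi>) \<and> wf_formula (trig_adapt \<psi>) \<and>
                    wf_formula (resp_core \<psi>) \<and> wf_formula (resp_adapt \<psi>) \<and> params \<psi> \<in> A}"

definition param_envelope :: "(real \<times> real \<times> real) set \<Rightarrow> bool" where
  "param_envelope A \<longleftrightarrow>
     A \<in> sets borel \<and> A \<subseteq> {(l, a, b). 0 \<le> l \<and> l \<le> 1 \<and> 0 \<le> a \<and> a \<le> b}"

definition admissible_revisions ::
  "(real \<times> real \<times> real) set \<Rightarrow> ('ap spec \<times> 'ap spec) set \<Rightarrow> bool" where
  "admissible_revisions A R \<longleftrightarrow>
     R \<subseteq> spec_set A \<times> spec_set A \<and>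
     (\<forall>(\<psi>, \<psi>') \<in> R.
        trig_core \<psi>' = trig_core \<psi> \<and> resp_core \<psi>' = resp_core \<psi> \<and>
        (trig_adapt \<psi>' = trig_adapt \<psi> \<or> resp_adapt \<psi>' = resp_adapt \<psi>) \<and>
        params \<psi>' \<in> A \<and>
        (trig_adapt \<psi>' \<noteq> trig_adapt \<psi> \<or> resp_adapt \<psi>' \<noteq> resp_adapt \<psi> \<or> params \<psi>' \<noteq> params \<psi>))"

text \<open>\<open>cemetery N\<close> is the measurable space \<open>N\<close> with one isolated point \<open>None\<close> adjoined.\<close>

definition cemetery :: "'a measure \<Rightarrow> 'a option measure" where
  "cemetery N = sigma (insert None (Some ` space N)) (insert {None} ((`) Some ` sets N))"

definition event_space :: "'ap event measure" where
  "event_space = borel \<Otimes>\<^sub>M count_space UNIV"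

datatype group = All | Core

text \<open>
  \<open>SpecM\<close>, \<open>PropM\<close> and \<open>XiM j\<close> are the measurable spaces in which the candidate, the set of proposed
  candidates and the internal randomness of version \<open>j\<close> take their values; their sigma-algebras are
  arbitrary. \<open>nstar j\<close>, \<open>props j\<close>, \<open>psistar j\<close>, \<open>xi j\<close> are the selection index, the proposed set, the
  selected candidate and the internal randomness while version \<open>j\<close> is active, with \<open>None\<close> as the
  cemetery value; \<open>alloc g j\<close> is the error allocation of group \<open>g\<close>.
\<close>

record ('w, 'ap, 'x) run =
  Prob :: "'w measure"
  ev :: "'w \<Rightarrow> 'ap tstream"
  Apar :: "(real \<times> real \<times> real) set"
  Rel :: "('ap spec \<times> 'ap spec) set"
  lam_core :: real
  SpecM :: "'ap spec measure"
  PropM :: "'ap spec set measure"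
  XiM :: "nat \<Rightarrow> 'x measure"
  psi0 :: "'w \<Rightarrow> 'ap spec"
  nstar :: "nat \<Rightarrow> 'w \<Rightarrow> enat"
  props :: "nat \<Rightarrow> 'w \<Rightarrow> 'ap spec set option"
  psistar :: "nat \<Rightarrow> 'w \<Rightarrow> 'ap spec option"
  xi :: "nat \<Rightarrow> 'w \<Rightarrow> 'x option"
  alloc :: "group \<Rightarrow> nat \<Rightarrow> 'w \<Rightarrow> real"

abbreviation time :: "('w, 'ap, 'x) run \<Rightarrow> nat \<Rightarrow> 'w \<Rightarrow> real" where
  "time r n \<omega> \<equiv> fst (ev r \<omega> n)"

text \<open>Meaningful only where a candidate is selected; all uses below are guarded accordingly.\<close>

definition cand :: "('w, 'ap, 'x) run \<Rightarrow> nat \<Rightarrow> 'w \<Rightarrow> 'ap spec" where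
  "cand r j \<omega> = the (psistar r j \<omega>)"

text \<open>
  A finite prefix is encoded as the sequence that continues with \<open>None\<close>; this generates the same
  sigma-algebra as the disjoint union of the finite powers of the event space.
\<close>

definition stopped_prefix :: "('w, 'ap, 'x) run \<Rightarrow> nat \<Rightarrow> 'w \<Rightarrow> nat \<Rightarrow> 'ap event option" where
  "stopped_prefix r j \<omega> =
     (\<lambda>i. if nstar r j \<omega> < \<infinity> \<and> enat i \<le> nstar r j \<omega> then Some (ev r \<omega> i) else None)"

definition Hsig :: "('w, 'ap, 'x) run \<Rightarrow> nat \<Rightarrow> 'w measure" where
  "Hsig r j =
     vimage_algebra (space (Prob r))
       (\<lambda>\<omega>. (nstar r j \<omega> < \<infinity>, nstar r j \<omega>, stopped_prefix r j \<omega>,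
             props r j \<omega>, psistar r j \<omega>, xi r j \<omega>))
       (count_space UNIV \<Otimes>\<^sub>M count_space UNIV \<Otimes>\<^sub>M (\<Pi>\<^sub>M i\<in>UNIV. cemetery event_space) \<Otimes>\<^sub>M
        cemetery (PropM r) \<Otimes>\<^sub>M cemetery (SpecM r) \<Otimes>\<^sub>M cemetery (XiM r j))"

definition enabled :: "('w, 'ap, 'x) run \<Rightarrow> nat \<Rightarrow> group \<Rightarrow> 'w \<Rightarrow> bool" where
  "enabled r j g \<omega> \<longleftrightarrow> (case g of All \<Rightarrow> True | Core \<Rightarrow> trig_core (cand r j \<omega>) \<noteq> Bot)"

definition group_trig :: "group \<Rightarrow> 'ap tstream \<Rightarrow> 'ap spec \<Rightarrow> nat \<Rightarrow> bool" where
  "group_trig g e \<psi> k \<longleftrightarrow>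
     sat e k (trig \<psi>) \<and> (case g of All \<Rightarrow> True | Core \<Rightarrow> sat e k (trig_core \<psi>))"

definition Kset :: "('w, 'ap, 'x) run \<Rightarrow> nat \<Rightarrow> group \<Rightarrow> nat \<Rightarrow> 'w \<Rightarrow> nat set" where
  "Kset r j g m \<omega> =
     {k. nstar r j \<omega> < enat k \<and> group_trig g (ev r \<omega>) (cand r j \<omega>) k \<and>
         time r m \<omega> > time r k \<omega> + spec_horizon (cand r j \<omega>)}"

definition Nsamp :: "('w, 'ap, 'x) run \<Rightarrow> nat \<Rightarrow> group \<Rightarrow> nat \<Rightarrow> 'w \<Rightarrow> nat" where
  "Nsamp r j g m \<omega> = card (Kset r j g m \<omega>)"

definition Kunion :: "('w, 'ap, 'x) run \<Rightarrow> nat \<Rightarrow> group \<Rightarrow> 'w \<Rightarrow> nat set" where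
  "Kunion r j g \<omega> = (\<Union>m\<in>{m. nstar r j \<omega> < enat m}. Kset r j g m \<omega>)"

text \<open>
  The samples are enumerated from \<open>s = 1\<close>. Where \<open>Kunion\<close> is finite (in particular if nothing is
  selected, or if the group is not enabled) the indices are set to \<open>0\<close> and the outcomes to \<open>False\<close>.
\<close>

definition kidx :: "('w, 'ap, 'x) run \<Rightarrow> nat \<Rightarrow> group \<Rightarrow> nat \<Rightarrow> 'w \<Rightarrow> nat" where
  "kidx r j g s \<omega> =
     (if infinite (Kunion r j g \<omega>) then enumerate (Kunion r j g \<omega>) (s - 1) else 0)"

definition tau :: "('w, 'ap, 'x) run \<Rightarrow> nat \<Rightarrow> group \<Rightarrow> nat \<Rightarrow> 'w \<Rightarrow> nat" where
  "tau r j g s \<omega> =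
     (if infinite (Kunion r j g \<omega>)
      then (LEAST m. nstar r j \<omega> < enat m \<and> s \<le> Nsamp r j g m \<omega>) else 0)"

definition Xsamp :: "('w, 'ap, 'x) run \<Rightarrow> nat \<Rightarrow> group \<Rightarrow> nat \<Rightarrow> 'w \<Rightarrow> bool" where
  "Xsamp r j g s \<omega> \<longleftrightarrow>
     infinite (Kunion r j g \<omega>) \<and> responds (ev r \<omega>) (cand r j \<omega>) (kidx r j g s \<omega>)"

text \<open>The identity map into \<open>Hsig r j\<close> contributes \<open>Hsig r j\<close> to the generated sigma-algebra.\<close>

definition Gsig :: "('w, 'ap, 'x) run \<Rightarrow> nat \<Rightarrow> group \<Rightarrow> nat \<Rightarrow> 'w measure" where
  "Gsig r j g s =
     vimage_algebra (space (Prob r))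
       (\<lambda>\<omega>. (\<omega>, \<lambda>i\<in>{1..s}. (kidx r j g i \<omega>, tau r j g i \<omega>, Xsamp r j g i \<omega>)))
       (Hsig r j \<Otimes>\<^sub>M (\<Pi>\<^sub>M i\<in>{1..s}. count_space UNIV))"

definition pcond :: "('w, 'ap, 'x) run \<Rightarrow> nat \<Rightarrow> group \<Rightarrow> nat \<Rightarrow> 'w \<Rightarrow> real" where
  "pcond r j g s =
     real_cond_exp (Prob r) (Gsig r j g (s - 1)) (\<lambda>\<omega>. of_bool (Xsamp r j g s \<omega>))"

definition pbar :: "('w, 'ap, 'x) run \<Rightarrow> nat \<Rightarrow> group \<Rightarrow> nat \<Rightarrow> 'w \<Rightarrow> real" where
  "pbar r j g q \<omega> = (1 / real q) * (\<Sum>s = 1..q. pcond r j g s \<omega>)"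

definition phat :: "('w, 'ap, 'x) run \<Rightarrow> nat \<Rightarrow> group \<Rightarrow> nat \<Rightarrow> 'w \<Rightarrow> real" where
  "phat r j g q \<omega> = (1 / real q) * (\<Sum>s = 1..q. of_bool (Xsamp r j g s \<omega>))"

definition alloc_at :: "('w, 'ap, 'x) run \<Rightarrow> nat \<Rightarrow> group \<Rightarrow> nat \<Rightarrow> 'w \<Rightarrow> real" where
  "alloc_at r j g q \<omega> = 6 * alloc r g j \<omega> / (pi\<^sup>2 * (real q)\<^sup>2)"

definition Lbound :: "('w, 'ap, 'x) run \<Rightarrow> nat \<Rightarrow> group \<Rightarrow> nat \<Rightarrow> 'w \<Rightarrow> real" where
  "Lbound r j g m \<omega> =
     (let q = Nsamp r j g m \<omega> in
      if q = 0 then 0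
      else max 0 (phat r j g q \<omega> - sqrt (ln (1 / alloc_at r j g q \<omega>) / (2 * real q))))"

definition threshold :: "('w, 'ap, 'x) run \<Rightarrow> nat \<Rightarrow> group \<Rightarrow> 'w \<Rightarrow> real" where
  "threshold r j g \<omega> = (case g of All \<Rightarrow> thr (cand r j \<omega>) | Core \<Rightarrow> lam_core r)"

definition mcert :: "('w, 'ap, 'x) run \<Rightarrow> nat \<Rightarrow> 'w \<Rightarrow> enat" where
  "mcert r j \<omega> =
     Inf (enat ` {m. nstar r j \<omega> < enat m \<and>
       (\<forall>g. enabled r j g \<omega> \<longrightarrow>
          Nsamp r j g m \<omega> > 0 \<and> Lbound r j g m \<omega> \<ge> threshold r j g \<omega>)})"

definition activated :: "('w, 'ap, 'x) run \<Rightarrow> nat \<Rightarrow> 'w \<Rightarrow> bool" where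
  "activated r j \<omega> \<longleftrightarrow> mcert r j \<omega> < \<infinity>"

primrec vstart :: "('w, 'ap, 'x) run \<Rightarrow> nat \<Rightarrow> 'w \<Rightarrow> enat" where
  "vstart r 0 \<omega> = 0"
| "vstart r (Suc j) \<omega> = (if activated r j \<omega> then mcert r j \<omega> + 1 else \<infinity>)"

primrec version :: "('w, 'ap, 'x) run \<Rightarrow> nat \<Rightarrow> 'w \<Rightarrow> 'ap spec option" where
  "version r 0 \<omega> = Some (psi0 r \<omega>)"
| "version r (Suc j) \<omega> = (if activated r j \<omega> then psistar r j \<omega> else None)"

definition Fail_group :: "('w, 'ap, 'x) run \<Rightarrow> nat \<Rightarrow> group \<Rightarrow> 'w set" where
  "Fail_group r j g =
     {\<omega> \<in> space (Prob r). activated r j \<omega> \<and> enabled r j g \<omega> \<and>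
        pbar r j g (Nsamp r j g (the_enat (vstart r (Suc j) \<omega>) - 1) \<omega>) \<omega> < threshold r j g \<omega>}"

definition Fail :: "('w, 'ap, 'x) run \<Rightarrow> nat \<Rightarrow> 'w set" where
  "Fail r j = Fail_group r j All \<union> Fail_group r j Core"

definition design :: "('w, 'ap, 'x) run \<Rightarrow> bool" where
  "design r \<longleftrightarrow>
     param_envelope (Apar r) \<and> admissible_revisions (Apar r) (Rel r) \<and>
     0 \<le> lam_core r \<and> lam_core r \<le> 1 \<and>
     space (SpecM r) = spec_set (Apar r) \<and> space (PropM r) \<subseteq> Pow (spec_set (Apar r))"

text \<open>
  Measurability of the primitive random objects and, since the sigma-algebra of \<open>SpecM\<close> is arbitrary,
  of the truth values, horizon and threshold obtained by inserting the random candidate.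
\<close>

definition measurable_objects :: "('w, 'ap, 'x) run \<Rightarrow> bool" where
  "measurable_objects r \<longleftrightarrow>
     (\<forall>i. (\<lambda>\<omega>. ev r \<omega> i) \<in> measurable (Prob r) event_space) \<and>
     psi0 r \<in> measurable (Prob r) (SpecM r) \<and>
     (\<forall>j. nstar r j \<in> measurable (Prob r) (count_space UNIV) \<and>
          props r j \<in> measurable (Prob r) (cemetery (PropM r)) \<and>
          psistar r j \<in> measurable (Prob r) (cemetery (SpecM r)) \<and>
          xi r j \<in> measurable (Prob r) (cemetery (XiM r j)) \<and>
          (\<forall>g k. Measurable.pred (Prob r)
             (\<lambda>\<omega>. nstar r j \<omega> < \<infinity> \<and> group_trig g (ev r \<omega>) (cand r j \<omega>) k)) \<and>
          (\<forall>k. Measurable.pred (Prob r)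
             (\<lambda>\<omega>. nstar r j \<omega> < \<infinity> \<and> responds (ev r \<omega>) (cand r j \<omega>) k)) \<and>
          (\<lambda>\<omega>. if nstar r j \<omega> < \<infinity> then spec_horizon (cand r j \<omega>) else 0)
             \<in> borel_measurable (Prob r) \<and>
          (\<lambda>\<omega>. if nstar r j \<omega> < \<infinity> then thr (cand r j \<omega>) else 0)
             \<in> borel_measurable (Prob r))"

definition selection :: "('w, 'ap, 'x) run \<Rightarrow> bool" where
  "selection r \<longleftrightarrow>
     (\<forall>j. \<forall>\<omega>\<in>space (Prob r).
        vstart r j \<omega> \<le> nstar r j \<omega> \<and>
        (nstar r j \<omega> = \<infinity> \<longrightarrow> props r j \<omega> = None \<and> psistar r j \<omega> = None \<and> xi r j \<omega> = None) \<and>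
        (nstar r j \<omega> < \<infinity> \<longrightarrow>
           (\<exists>P \<psi> \<psi>' x. props r j \<omega> = Some P \<and> version r j \<omega> = Some \<psi> \<and> psistar r j \<omega> = Some \<psi>' \<and>
              xi r j \<omega> = Some x \<and> \<psi>' \<in> P \<and> (\<psi>, \<psi>') \<in> Rel r)))"

definition recurrence :: "('w, 'ap, 'x) run \<Rightarrow> nat \<Rightarrow> bool" where
  "recurrence r j \<longleftrightarrow>
     (\<forall>g. AE \<omega> in Prob r. nstar r j \<omega> < \<infinity> \<and> enabled r j g \<omega> \<longrightarrow> infinite (Kunion r j g \<omega>))"

definition allocations :: "('w, 'ap, 'x) run \<Rightarrow> nat \<Rightarrow> ('w \<Rightarrow> real) \<Rightarrow> bool" where
  "allocations r j budget \<longleftrightarrow>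
     (\<forall>g. alloc r g j \<in> borel_measurable (Hsig r j)) \<and>
     (\<forall>\<omega>\<in>space (Prob r). nstar r j \<omega> < \<infinity> \<longrightarrow>
        0 < alloc r All j \<omega> \<and>
        (if enabled r j Core \<omega> then 0 < alloc r Core j \<omega> else alloc r Core j \<omega> = 0) \<and>
        alloc r All j \<omega> + alloc r Core j \<omega> \<le> budget \<omega>)"

end

theory Submission
  imports Defs
begin

text \<open>
  Fix a version and a group. The deviations \<open>X\<^sub>s - p\<^sub>s\<close> of the sampled outcomes from their conditional
  probabilities are martingale differences for the sigma-algebras \<open>G\<^sub>s\<close>, and by Hoeffding's lemma
  \<open>exp (h \<Sum>(X\<^sub>s - p\<^sub>s) - q h\<^sup>2 / 8)\<close> is a supermartingale for every exponent \<open>h \<ge> 0\<close> known at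
  selection time. Weighting it by the allocation \<open>\<delta>\<^sub>q\<close>, also known at selection time, and applying
  Markov's inequality bounds the probability that the lower confidence bound fails at sample size
  \<open>q\<close> by the expectation of \<open>\<delta>\<^sub>q\<close>. Since \<open>\<Sum>1/q\<^sup>2 = \<pi>\<^sup>2/6\<close>, a union bound over \<open>q\<close> covers the random
  sample size at activation, and union bounds over groups and versions give the expectation of
  \<open>\<Sum>\<delta>\<^sub>j\<close>, which is at most \<open>\<delta>\<close>.
\<close>

section \<open>Exponential inequalities with a random exponent\<close>

text \<open>For a Bernoulli variable \<open>X\<close> with mean \<open>p\<close>, the left-hand side
  is the expectation of \<open>exp (h * (X - p))\<close>. This is Hoeffding's lemma in
  multiplicative form, obtained by exponentiating \<open>Hoeffdings_lemma_aux\<close>.\<close>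

lemma exp_neg_mult_bernoulli_mgf_le:
  fixes h p :: real
  assumes "0 \<le> h" and "0 \<le> p"
  shows "exp (- h * p) * (1 + p * (exp h - 1)) \<le> exp (h\<^sup>2 / 8)"
proof -
  have pos: "0 < 1 + p * (exp h - 1)"
    using assms by (intro add_pos_nonneg mult_nonneg_nonneg) auto
  have "exp (- h * p) * (1 + p * (exp h - 1)) = exp (- h * p + ln (1 + p * (exp h - 1)))"
    using pos by (simp only: exp_add exp_ln)
  also have "\<dots> \<le> exp (h\<^sup>2 / 8)"
    using Hoeffdings_lemma_aux[OF assms] by simp
  finally show ?thesis .
qed

text \<open>One step of the supermartingale. Given \<open>F\<close>, the weight \<open>W\<close>,
  the exponent \<open>h\<close> and the mean \<open>p\<close> are constants and \<open>X\<close> is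
  Bernoulli with mean \<open>p\<close>, so the scalar inequality applies conditionally. Nonnegative
  integrals avoid integrability conditions on \<open>W\<close> and \<open>h\<close>.\<close>

lemma (in prob_space) nn_integral_exp_centred_le:
  fixes W :: "'a \<Rightarrow> ennreal" and h :: "'a \<Rightarrow> real"
  assumes sub: "subalgebra M F"
    and X[measurable]: "Measurable.pred M X"
    and h[measurable]: "h \<in> borel_measurable F" and h0: "\<And>\<omega>. 0 \<le> h \<omega>"
    and W[measurable]: "W \<in> borel_measurable F"
  defines "p \<equiv> real_cond_exp M F (\<lambda>\<omega>. of_bool (X \<omega>))"
  shows "(\<integral>\<^sup>+\<omega>. W \<omega> * ennreal (exp (h \<omega> * (of_bool (X \<omega>) - p \<omega>) - (h \<omega>)\<^sup>2 / 8)) \<partial>M)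
           \<le> (\<integral>\<^sup>+\<omega>. W \<omega> \<partial>M)"
proof -
  interpret finite_measure_subalgebra M F
    by unfold_locales (fact sub)
  note fromF = measurable_from_subalg[OF sub]
  have p[measurable]: "p \<in> borel_measurable F"
    by (simp add: p_def)
  note [measurable] = fromF[OF p] fromF[OF h] fromF[OF W]
  \<comment> \<open>\<open>real_cond_exp\<close> is the difference of the \<open>nn_cond_exp\<close>
    of the positive and the negative part. The negative part contributes 0 and \<open>N\<close> is
    at most 1, hence finite, so \<open>N\<close> and \<open>p\<close> agree almost
    everywhere.\<close>
  define N where "N = nn_cond_exp M F (\<lambda>\<omega>. ennreal (of_bool (X \<omega>)))"
  have "AE \<omega> in M. N \<omega> \<le> nn_cond_exp M F (\<lambda>_. 1) \<omega>"
    unfolding N_def by (rule nn_cond_exp_mono) auto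
  moreover have "AE \<omega> in M. 1 = nn_cond_exp M F (\<lambda>_. 1) \<omega>"
    by (rule nn_cond_exp_F_meas) simp
  ultimately have N1: "AE \<omega> in M. N \<omega> \<le> 1"
    by eventually_elim simp
  have "AE \<omega> in M. 0 = nn_cond_exp M F (\<lambda>_. 0) \<omega>"
    by (rule nn_cond_exp_F_meas) simp
  then have N0: "AE \<omega> in M. nn_cond_exp M F (\<lambda>\<omega>. ennreal (- of_bool (X \<omega>))) \<omega> = 0"
    by eventually_elim (simp add: ennreal_neg)
  have Np: "AE \<omega> in M. N \<omega> = ennreal (p \<omega>) \<and> 0 \<le> p \<omega>"
    using N0 N1
  proof eventually_elim
    case (elim \<omega>)
    then have "p \<omega> = enn2real (N \<omega>)"
      by (simp add: p_def real_cond_exp_def N_def)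
    moreover have "N \<omega> < \<top>"
      using elim(2) by (auto simp: top_unique less_top[symmetric])
    ultimately show ?case by simp
  qed
  \<comment> \<open>As \<open>X\<close> takes only two values,
    \<open>exp (h X) = 1 + (exp h - 1) X\<close> is affine in \<open>X\<close>. \<open>V\<close> is
    the integrand at \<open>X = 0\<close> and \<open>U\<close> the coefficient of \<open>X\<close>;
    both are \<open>F\<close>-measurable.\<close>
  define V where "V \<omega> = W \<omega> * ennreal (exp (- h \<omega> * p \<omega> - (h \<omega>)\<^sup>2 / 8))" for \<omega>
  define U where "U \<omega> = V \<omega> * ennreal (exp (h \<omega>) - 1)" for \<omega>
  have [measurable]: "V \<in> borel_measurable F" "U \<in> borel_measurable F"
    unfolding V_def U_def by measurable
  note [measurable] = fromF[OF \<open>V \<in> borel_measurable F\<close>] fromF[OF \<open>U \<in> borel_measurable F\<close>]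
  have [measurable]: "N \<in> borel_measurable M"
    by (simp add: N_def)
  have split: "W \<omega> * ennreal (exp (h \<omega> * (of_bool (X \<omega>) - p \<omega>) - (h \<omega>)\<^sup>2 / 8))
      = V \<omega> + U \<omega> * ennreal (of_bool (X \<omega>))" for \<omega>
  proof (cases "X \<omega>")
    case True
    have "exp (h \<omega> * (1 - p \<omega>) - (h \<omega>)\<^sup>2 / 8) = exp (- h \<omega> * p \<omega> - (h \<omega>)\<^sup>2 / 8) * exp (h \<omega>)"
      by (simp add: exp_add[symmetric] algebra_simps)
    also have "ennreal \<dots> = ennreal (exp (- h \<omega> * p \<omega> - (h \<omega>)\<^sup>2 / 8))
        + ennreal (exp (- h \<omega> * p \<omega> - (h \<omega>)\<^sup>2 / 8)) * ennreal (exp (h \<omega>) - 1)"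
      using h0[of \<omega>] by (simp add: ennreal_mult[symmetric] ennreal_plus[symmetric] algebra_simps del: ennreal_plus)
    finally show ?thesis
      using True by (simp add: U_def V_def distrib_left mult.assoc)
  qed (simp add: V_def)
  have "(\<integral>\<^sup>+\<omega>. W \<omega> * ennreal (exp (h \<omega> * (of_bool (X \<omega>) - p \<omega>) - (h \<omega>)\<^sup>2 / 8)) \<partial>M)
      = (\<integral>\<^sup>+\<omega>. V \<omega> \<partial>M) + (\<integral>\<^sup>+\<omega>. U \<omega> * ennreal (of_bool (X \<omega>)) \<partial>M)"
    unfolding split by (rule nn_integral_add) auto
  \<comment> \<open>Since \<open>U\<close> is \<open>F\<close>-measurable, \<open>X\<close> may be
    replaced by its conditional expectation.\<close>
  also have "(\<integral>\<^sup>+\<omega>. U \<omega> * ennreal (of_bool (X \<omega>)) \<partial>M) = (\<integral>\<^sup>+\<omega>. U \<omega> * N \<omega> \<partial>M)"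
    unfolding N_def by (rule nn_cond_exp_intg[symmetric]) auto
  also have "(\<integral>\<^sup>+\<omega>. V \<omega> \<partial>M) + \<dots> = (\<integral>\<^sup>+\<omega>. V \<omega> + U \<omega> * N \<omega> \<partial>M)"
    by (rule nn_integral_add[symmetric]) auto
  also have "\<dots> \<le> (\<integral>\<^sup>+\<omega>. W \<omega> \<partial>M)"
  proof (rule nn_integral_mono_AE)
    show "AE \<omega> in M. V \<omega> + U \<omega> * N \<omega> \<le> W \<omega>"
      using Np
    proof eventually_elim
      case (elim \<omega>)
      have "V \<omega> + U \<omega> * N \<omega>
          = V \<omega> * ennreal (1 + p \<omega> * (exp (h \<omega>) - 1))"
        using elim h0[of \<omega>]
        by (simp add: U_def distrib_left ennreal_plus ennreal_mult mult.assoc mult.commute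
              del: ennreal_plus) (simp add: ennreal_plus distrib_left mult_ac ennreal_mult)
      also have "\<dots> = W \<omega> * ennreal (exp (- h \<omega> * p \<omega> - (h \<omega>)\<^sup>2 / 8) * (1 + p \<omega> * (exp (h \<omega>) - 1)))"
        using elim h0[of \<omega>] by (simp add: V_def ennreal_mult mult.assoc)
      also have "\<dots> \<le> W \<omega> * 1"
      proof (rule mult_left_mono)
        have "exp (- h \<omega> * p \<omega> - (h \<omega>)\<^sup>2 / 8) * (1 + p \<omega> * (exp (h \<omega>) - 1))
            = exp (- ((h \<omega>)\<^sup>2 / 8)) * (exp (- h \<omega> * p \<omega>) * (1 + p \<omega> * (exp (h \<omega>) - 1)))"
          by (simp add: exp_add[symmetric] mult.assoc[symmetric])
        also have "\<dots> \<le> exp (- ((h \<omega>)\<^sup>2 / 8)) * exp ((h \<omega>)\<^sup>2 / 8)"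
          using elim h0[of \<omega>] by (intro mult_left_mono exp_neg_mult_bernoulli_mgf_le) auto
        also have "\<dots> = 1"
          by (simp add: exp_add[symmetric])
        finally show "ennreal (exp (- h \<omega> * p \<omega> - (h \<omega>)\<^sup>2 / 8) * (1 + p \<omega> * (exp (h \<omega>) - 1))) \<le> 1"
          by simp
      qed simp
      finally show ?case by simp
    qed
  qed
  finally show ?thesis .
qed

text \<open>Hoeffding's inequality at a fixed sample size and a random level \<open>D\<close> known
  at time 0. The factor \<open>D\<close> is kept inside the expectation: \<open>D\<close> times the
  exponential starts at \<open>D\<close>, does not grow in expectation, and is at least 1 on the bad
  event.\<close>

lemma (in prob_space) adaptive_hoeffding:
  fixes F :: "nat \<Rightarrow> 'a measure" and X :: "nat \<Rightarrow> 'a \<Rightarrow> bool" and D :: "'a \<Rightarrow> real"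
  assumes sub: "\<And>s. subalgebra M (F s)"
    and mono: "\<And>s. subalgebra (F (Suc s)) (F s)"
    and X: "\<And>s. Measurable.pred (F (Suc s)) (X (Suc s))"
    and E: "Measurable.pred (F 0) E"
    and D: "D \<in> borel_measurable (F 0)"
    and D01: "\<And>\<omega>. \<omega> \<in> space M \<Longrightarrow> E \<omega> \<Longrightarrow> 0 < D \<omega> \<and> D \<omega> \<le> 1"
    and q: "0 < q"
  defines "p \<equiv> \<lambda>s. real_cond_exp M (F (s - 1)) (\<lambda>\<omega>. of_bool (X s \<omega>))"
  shows "emeasure M {\<omega> \<in> space M. E \<omega> \<and>
           1 / real q * (\<Sum>s = 1..q. p s \<omega>)
             < 1 / real q * (\<Sum>s = 1..q. of_bool (X s \<omega>)) - sqrt (ln (1 / D \<omega>) / (2 * real q))}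
         \<le> (\<integral>\<^sup>+\<omega>. (if E \<omega> then ennreal (D \<omega>) else 0) \<partial>M)"
    (is "emeasure M ?B \<le> ?I")
proof -
  \<comment> \<open>The exponent minimising the Chernoff bound \<open>exp (- h q \<epsilon> + q h\<^sup>2 / 8)\<close>; it is random but
    known at time 0, and unbounded if \<open>D\<close> comes close to 0, whence the use of nonnegative integrals.\<close>
  define h where "h \<omega> = (if E \<omega> then 4 * sqrt (ln (1 / D \<omega>) / (2 * real q)) else 0)" for \<omega>
  \<comment> \<open>Off \<open>space M\<close> nothing bounds \<open>D\<close>, and
    \<open>sqrt\<close> is negative at negative arguments; the truncation makes the exponent
    nonnegative at every point, as the one-step bound requires. On \<open>space M\<close> it changes
    nothing.\<close>
  define h' where "h' \<omega> = max 0 (h \<omega>)" for \<omega>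
  define w where "w \<omega> = (if E \<omega> then ennreal (D \<omega>) else 0)" for \<omega>
  define S where "S n \<omega> = (\<Sum>s = 1..n. of_bool (X s \<omega>) - p s \<omega>)" for n \<omega>
  define Z where "Z n \<omega> = w \<omega> * ennreal (exp (h' \<omega> * S n \<omega> - real n * ((h' \<omega>)\<^sup>2 / 8)))" for n \<omega>
  have F_mono: "subalgebra (F t) (F s)" if "s \<le> t" for s t
    using that
  proof (induction rule: dec_induct)
    case base
    then show ?case by (simp add: subalgebra_def)
  next
    case (step n)
    then show ?case using mono[of n] by (auto simp: subalgebra_def)
  qed
  note up = measurable_from_subalg[OF F_mono]
  have p_meas: "p s \<in> borel_measurable (F t)" if "s - 1 \<le> t" for s t
    unfolding p_def by (rule up[OF that]) simp
  have X_meas: "Measurable.pred (F t) (X s)" if "1 \<le> s" "s \<le> t" for s t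
    using that by (cases s) (auto intro: up[OF _ X])
  have h_meas: "h' \<in> borel_measurable (F n)" and w_meas: "w \<in> borel_measurable (F n)" for n
  proof -
    note [measurable] = up[of 0 n, OF _ E, simplified] up[of 0 n, OF _ D, simplified]
    show "h' \<in> borel_measurable (F n)"
      unfolding h'_def h_def by measurable
    show "w \<in> borel_measurable (F n)"
      unfolding w_def by measurable
  qed
  have S_meas: "S n \<in> borel_measurable (F n)" for n
    unfolding S_def
  proof (intro borel_measurable_sum borel_measurable_diff)
    fix s assume s: "s \<in> {1..n}"
    have [measurable]: "Measurable.pred (F n) (X s)"
      using s by (intro X_meas) auto
    show "(\<lambda>\<omega>. of_bool (X s \<omega>) :: real) \<in> borel_measurable (F n)"
      by measurable
    show "p s \<in> borel_measurable (F n)"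
      using s by (intro p_meas) auto
  qed
  have Z_meas: "Z n \<in> borel_measurable (F n)" for n
  proof -
    note [measurable] = h_meas[of n] w_meas[of n] S_meas[of n]
    show ?thesis unfolding Z_def by measurable
  qed
  have Z_le: "(\<integral>\<^sup>+\<omega>. Z n \<omega> \<partial>M) \<le> ?I" for n
  proof (induction n)
    case 0
    then show ?case by (simp add: Z_def S_def w_def)
  next
    case (Suc n)
    have X_M: "Measurable.pred M (X (Suc n))"
      by (rule measurable_from_subalg[OF sub X])
    have "Z (Suc n) \<omega> = Z n \<omega> * ennreal (exp (h' \<omega> * (of_bool (X (Suc n) \<omega>) - p (Suc n) \<omega>) - (h' \<omega>)\<^sup>2 / 8))" for \<omega>
    proof -
      have "S (Suc n) \<omega> = S n \<omega> + (of_bool (X (Suc n) \<omega>) - p (Suc n) \<omega>)"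
        by (simp add: S_def)
      then have "exp (h' \<omega> * S (Suc n) \<omega> - real (Suc n) * ((h' \<omega>)\<^sup>2 / 8))
          = exp (h' \<omega> * S n \<omega> - real n * ((h' \<omega>)\<^sup>2 / 8))
            * exp (h' \<omega> * (of_bool (X (Suc n) \<omega>) - p (Suc n) \<omega>) - (h' \<omega>)\<^sup>2 / 8)"
        by (simp only: exp_add[symmetric]) (simp add: algebra_simps)
      then show ?thesis
        by (simp add: Z_def ennreal_mult mult.assoc)
    qed
    then have "(\<integral>\<^sup>+\<omega>. Z (Suc n) \<omega> \<partial>M) \<le> (\<integral>\<^sup>+\<omega>. Z n \<omega> \<partial>M)"
      using nn_integral_exp_centred_le[OF sub X_M h_meas _ Z_meas, of n]
      by (simp add: p_def h'_def)
    with Suc.IH show ?case by (rule order_trans[rotated])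
  qed
  have "emeasure M ?B \<le> emeasure M {\<omega> \<in> space M. 1 \<le> Z q \<omega>}"
  proof (rule emeasure_mono)
    show "{\<omega> \<in> space M. 1 \<le> Z q \<omega>} \<in> sets M"
      using measurable_from_subalg[OF sub Z_meas] by measurable
    show "?B \<subseteq> {\<omega> \<in> space M. 1 \<le> Z q \<omega>}"
    proof safe
      fix \<omega>
      assume \<omega>: "\<omega> \<in> space M" "E \<omega>"
        and dev: "1 / real q * (\<Sum>s = 1..q. p s \<omega>)
             < 1 / real q * (\<Sum>s = 1..q. of_bool (X s \<omega>)) - sqrt (ln (1 / D \<omega>) / (2 * real q))"
      define \<epsilon> where "\<epsilon> = sqrt (ln (1 / D \<omega>) / (2 * real q))"
      have D: "0 < D \<omega>" "D \<omega> \<le> 1"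
        using D01 \<omega> by auto
      then have L0: "0 \<le> ln (1 / D \<omega>)"
        by simp
      then have \<epsilon>: "0 \<le> \<epsilon>" "2 * real q * \<epsilon>\<^sup>2 = ln (1 / D \<omega>)"
        using q by (auto simp: \<epsilon>_def)
      have h: "h' \<omega> = 4 * \<epsilon>"
        using \<omega> \<epsilon>(1) by (simp add: h'_def h_def \<epsilon>_def)
      have "S q \<omega> = (\<Sum>s = 1..q. of_bool (X s \<omega>)) - (\<Sum>s = 1..q. p s \<omega>)"
        by (simp add: S_def sum_subtractf)
      then have "\<epsilon> * real q \<le> S q \<omega>"
        using dev q unfolding \<epsilon>_def[symmetric] by (simp add: field_simps)
      then have "4 * \<epsilon> * (\<epsilon> * real q) \<le> 4 * \<epsilon> * S q \<omega>"
        using \<epsilon>(1) by (intro mult_left_mono) auto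
      \<comment> \<open>With \<open>h' = 4 \<epsilon>\<close> and
        \<open>S \<ge> q \<epsilon>\<close>, the exponent is at least \<open>4 q \<epsilon>\<^sup>2
        - 2 q \<epsilon>\<^sup>2 = 2 q \<epsilon>\<^sup>2\<close>, which is the logarithm on the
        left.\<close>
      then have "ln (1 / D \<omega>) \<le> h' \<omega> * S q \<omega> - real q * ((h' \<omega>)\<^sup>2 / 8)"
        unfolding h \<epsilon>(2)[symmetric] by (simp add: power2_eq_square algebra_simps)
      then have "1 / D \<omega> \<le> exp (h' \<omega> * S q \<omega> - real q * ((h' \<omega>)\<^sup>2 / 8))"
        using D by (metis exp_le_cancel_iff exp_ln zero_less_divide_1_iff)
      then have "1 \<le> D \<omega> * exp (h' \<omega> * S q \<omega> - real q * ((h' \<omega>)\<^sup>2 / 8))"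
        using D by (simp add: field_simps)
      then show "1 \<le> Z q \<omega>"
        using \<omega> D by (simp add: Z_def w_def ennreal_mult[symmetric])
    qed
  qed
  also have "\<dots> \<le> (\<integral>\<^sup>+\<omega>. Z q \<omega> \<partial>M)"
  proof -
    have [measurable]: "Z q \<in> borel_measurable M"
      by (rule measurable_from_subalg[OF sub Z_meas])
    have "emeasure M {\<omega> \<in> space M. 1 \<le> 1 * Z q \<omega>} \<le> 1 * (\<integral>\<^sup>+\<omega>\<in>space M. Z q \<omega> \<partial>M)"
      by (rule nn_integral_Markov_inequality) measurable
    also have "(\<integral>\<^sup>+\<omega>\<in>space M. Z q \<omega> \<partial>M) = (\<integral>\<^sup>+\<omega>. Z q \<omega> \<partial>M)"
      by (rule nn_integral_cong) simp
    finally show ?thesis by simp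
  qed
  also have "\<dots> \<le> ?I"
    by (rule Z_le)
  finally show ?thesis .
qed

section \<open>Measurability tools and nonnegative horizons\<close>

lemma subalgebraI_measurable_ident:
  assumes "(\<lambda>\<omega>. \<omega>) \<in> measurable M F" and "space F = space M"
  shows "subalgebra M F"
proof -
  have "A \<in> sets M" if "A \<in> sets F" for A
    using measurable_sets[OF assms(1) that] sets.sets_into_space[OF that] assms(2)
    by (simp add: Int_absorb2)
  with assms(2) show ?thesis
    by (auto simp: subalgebra_def)
qed

text \<open>The recursion of \<open>enumerate\<close> removes the least element, so the induction
  must range over all random sets \<open>S\<close>, including the one left after that
  removal.\<close>

lemma measurable_enumerate:
  fixes S :: "'a \<Rightarrow> nat set"
  assumes "\<And>k. Measurable.pred M (\<lambda>\<omega>. k \<in> S \<omega>)"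
  shows "(\<lambda>\<omega>. enumerate (S \<omega>) n) \<in> measurable M (count_space UNIV)"
  using assms
proof (induction n arbitrary: S)
  case 0
  show ?case
    unfolding enumerate_0 by (rule measurable_Least) (rule 0)
next
  case (Suc n)
  have [measurable]: "(\<lambda>\<omega>. LEAST i. i \<in> S \<omega>) \<in> measurable M (count_space UNIV)"
    by (rule measurable_Least) (rule Suc.prems)
  have "Measurable.pred M (\<lambda>\<omega>. k \<in> S \<omega> - {LEAST i. i \<in> S \<omega>})" for k
  proof -
    have "Measurable.pred M (\<lambda>\<omega>. \<not> k = (LEAST i. i \<in> S \<omega>))"
      by measurable
    from pred_intros_logic(3)[OF Suc.prems[of k] this] show ?thesis
      by simp
  qed
  then show ?case
    unfolding enumerate_Suc by (rule Suc.IH)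
qed

lemma less_enat_imp_finite: "x < enat k \<Longrightarrow> x < \<infinity>"
  by (cases x) simp_all

lemma space_cemetery: "space (cemetery N) = insert None (Some ` space N)"
  unfolding cemetery_def using sets.sets_into_space[of _ N]
  by (intro space_measure_of) auto

lemma measurable_cemetery:
  assumes "Measurable.pred M P" and f: "f \<in> measurable M N"
  shows "(\<lambda>\<omega>. if P \<omega> then Some (f \<omega>) else None) \<in> measurable M (cemetery N)"
  unfolding cemetery_def
proof (rule measurable_measure_of)
  note [measurable] = assms
  show "insert {None} ((`) Some ` sets N) \<subseteq> Pow (insert None (Some ` space N))"
    using sets.sets_into_space[of _ N] by auto
  show "(\<lambda>\<omega>. if P \<omega> then Some (f \<omega>) else None) \<in> space M \<rightarrow> insert None (Some ` space N)"
    using measurable_space[OF f] by auto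
  fix A assume "A \<in> insert {None} ((`) Some ` sets N)"
  then consider "A = {None}" | B where "B \<in> sets N" "A = Some ` B"
    by auto
  then show "(\<lambda>\<omega>. if P \<omega> then Some (f \<omega>) else None) -` A \<inter> space M \<in> sets M"
  proof cases
    case 1
    then have "(\<lambda>\<omega>. if P \<omega> then Some (f \<omega>) else None) -` A \<inter> space M = {\<omega> \<in> space M. \<not> P \<omega>}"
      by auto
    then show ?thesis by simp
  next
    case 2
    then have "(\<lambda>\<omega>. if P \<omega> then Some (f \<omega>) else None) -` A \<inter> space M
        = {\<omega> \<in> space M. P \<omega>} \<inter> (f -` B \<inter> space M)"
      by (auto split: if_splits)
    then show ?thesis
      using measurable_sets[OF f \<open>B \<in> sets N\<close>] by simp
  qed
qed

lemma hzn_nonneg: "wf_formula f \<Longrightarrow> 0 \<le> hzn f"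
  by (induction f) (auto simp: le_max_iff_disj)

lemma spec_horizon_nonneg:
  assumes "wf_formula (trig_core \<psi>)"
  shows "0 \<le> spec_horizon \<psi>"
  using hzn_nonneg[OF assms] by (simp add: spec_horizon_def trig_def le_max_iff_disj)

section \<open>The run and the measurability of its samples\<close>

locale certified_run =
  fixes r :: "('w, 'ap :: finite, 'x) run" and budget :: "nat \<Rightarrow> 'w \<Rightarrow> real"
  assumes prob: "prob_space (Prob r)"
    and design: "design r"
    and streams: "\<And>\<omega>. \<omega> \<in> space (Prob r) \<Longrightarrow> timed_stream (ev r \<omega>)"
    and objects: "measurable_objects r"
    and selection: "selection r"
    and allocations: "\<And>j. allocations r j (budget j)"
    and budget_meas: "\<And>j. budget j \<in> borel_measurable (Hsig r j)"
    and budget: "\<And>j \<omega>. \<omega> \<in> space (Prob r) \<Longrightarrow> 0 < budget j \<omega> \<and> budget j \<omega> < 1"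
begin

sublocale prob_space "Prob r"
  by (rule prob)

lemma cand_wf:
  assumes "\<omega> \<in> space (Prob r)" and "nstar r j \<omega> < \<infinity>"
  shows "wf_formula (trig_core (cand r j \<omega>))"
proof -
  obtain \<psi> \<psi>' where "psistar r j \<omega> = Some \<psi>'" "(\<psi>, \<psi>') \<in> Rel r"
    using selection assms unfolding selection_def by blast
  then show ?thesis
    using design by (auto simp: design_def admissible_revisions_def spec_set_def cand_def)
qed

text \<open>A sample is counted only after a nonnegative horizon has strictly elapsed, so its time
  is strictly earlier, and monotone time stamps make its index smaller. Hence sample sets are finite
  and \<open>Nsamp\<close> is a finite sum of indicators.\<close>

lemma Kset_subset:
  assumes "\<omega> \<in> space (Prob r)"
  shows "Kset r j g m \<omega> \<subseteq> {..<m}"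
proof
  fix k assume k: "k \<in> Kset r j g m \<omega>"
  then have "nstar r j \<omega> < \<infinity>"
    by (auto simp only: Kset_def mem_Collect_eq intro: less_enat_imp_finite)
  then have "time r k \<omega> < time r m \<omega>"
    using k spec_horizon_nonneg[OF cand_wf[OF assms]] by (force simp: Kset_def)
  moreover have "mono (\<lambda>n. time r n \<omega>)"
    using streams[OF assms] by (simp add: timed_stream_def mono_iff_le_Suc)
  ultimately show "k \<in> {..<m}"
    by (metis lessThan_iff monoD not_le)
qed

lemma time_meas [measurable]: "time r n \<in> borel_measurable (Prob r)"
proof -
  have "(\<lambda>\<omega>. ev r \<omega> n) \<in> measurable (Prob r) event_space"
    using objects by (simp add: measurable_objects_def)
  then show ?thesis
    unfolding event_space_def by (rule measurable_compose) simp
qed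

lemma nstar_meas: "nstar r j \<in> measurable (Prob r) (count_space UNIV)"
  using objects by (simp add: measurable_objects_def)

lemma nstar_pred [measurable]:
  "Measurable.pred (Prob r) (\<lambda>\<omega>. nstar r j \<omega> < c)"
  "Measurable.pred (Prob r) (\<lambda>\<omega>. c \<le> nstar r j \<omega>)"
  by (rule measurable_compose[OF nstar_meas]; simp)+

lemma props_meas: "props r j \<in> measurable (Prob r) (cemetery (PropM r))"
  and psistar_meas: "psistar r j \<in> measurable (Prob r) (cemetery (SpecM r))"
  and xi_meas: "xi r j \<in> measurable (Prob r) (cemetery (XiM r j))"
  using objects by (simp_all add: measurable_objects_def)

lemma trig_meas [measurable]:
  "Measurable.pred (Prob r) (\<lambda>\<omega>. nstar r j \<omega> < \<infinity> \<and> group_trig g (ev r \<omega>) (cand r j \<omega>) k)"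
  using objects by (simp add: measurable_objects_def)

lemma responds_meas [measurable]:
  "Measurable.pred (Prob r) (\<lambda>\<omega>. nstar r j \<omega> < \<infinity> \<and> responds (ev r \<omega>) (cand r j \<omega>) k)"
  using objects by (simp add: measurable_objects_def)

lemma horizon_meas [measurable]:
  "(\<lambda>\<omega>. if nstar r j \<omega> < \<infinity> then spec_horizon (cand r j \<omega>) else 0) \<in> borel_measurable (Prob r)"
  using objects by (simp add: measurable_objects_def)

lemma thr_meas [measurable]:
  "(\<lambda>\<omega>. if nstar r j \<omega> < \<infinity> then thr (cand r j \<omega>) else 0) \<in> borel_measurable (Prob r)"
  using objects by (simp add: measurable_objects_def)

lemma Kset_meas [measurable]: "Measurable.pred (Prob r) (\<lambda>\<omega>. k \<in> Kset r j g m \<omega>)"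
proof -
  \<comment> \<open>Candidate-dependent quantities are measurable only under the guard
    \<open>nstar < \<infinity>\<close>. The guard can be inserted because
    \<open>nstar < enat k\<close> implies it.\<close>
  have "(\<lambda>\<omega>. k \<in> Kset r j g m \<omega>) = (\<lambda>\<omega>. nstar r j \<omega> < enat k \<and>
      (nstar r j \<omega> < \<infinity> \<and> group_trig g (ev r \<omega>) (cand r j \<omega>) k) \<and>
      time r k \<omega> + (if nstar r j \<omega> < \<infinity> then spec_horizon (cand r j \<omega>) else 0) < time r m \<omega>)"
    using less_enat_imp_finite by (auto simp only: Kset_def mem_Collect_eq fun_eq_iff if_True)
  then show ?thesis
    by (simp only:) measurable
qed

lemma Kunion_meas [measurable]: "Measurable.pred (Prob r) (\<lambda>\<omega>. k \<in> Kunion r j g \<omega>)"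
proof -
  have "(\<lambda>\<omega>. k \<in> Kunion r j g \<omega>) = (\<lambda>\<omega>. \<exists>m. nstar r j \<omega> < enat m \<and> k \<in> Kset r j g m \<omega>)"
    by (auto simp: Kunion_def fun_eq_iff)
  then show ?thesis
    by (simp only:) measurable
qed

lemma infinite_Kunion_meas [measurable]:
  "Measurable.pred (Prob r) (\<lambda>\<omega>. infinite (Kunion r j g \<omega>))"
  \<comment> \<open>Unboundedness expresses infinitude by quantifiers over natural numbers, hence by
    countable operations.\<close>
  unfolding infinite_nat_iff_unbounded by measurable

lemma Nsamp_meas [measurable]: "Nsamp r j g m \<in> measurable (Prob r) (count_space UNIV)"
proof -
  have "Nsamp r j g m \<omega> = (\<Sum>k<m. if k \<in> Kset r j g m \<omega> then 1 else 0)"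
    if "\<omega> \<in> space (Prob r)" for \<omega>
    using Kset_subset[OF that]
    by (simp add: Nsamp_def sum.If_cases Int_absorb1)
  then show ?thesis
    by (subst measurable_cong) (assumption, measurable)
qed

lemma kidx_meas [measurable]: "kidx r j g s \<in> measurable (Prob r) (count_space UNIV)"
proof -
  have [measurable]: "(\<lambda>\<omega>. enumerate (Kunion r j g \<omega>) (s - 1)) \<in> measurable (Prob r) (count_space UNIV)"
    by (rule measurable_enumerate) simp
  show ?thesis
    unfolding kidx_def[abs_def] by measurable
qed

lemma tau_meas [measurable]: "tau r j g s \<in> measurable (Prob r) (count_space UNIV)"
  unfolding tau_def[abs_def] by measurable

lemma Xsamp_meas [measurable]: "Measurable.pred (Prob r) (Xsamp r j g s)"
proof -
  have "nstar r j \<omega> < \<infinity>" if "infinite (Kunion r j g \<omega>)" for \<omega>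
  proof -
    have "Kunion r j g \<omega> \<noteq> {}"
      using that by auto
    then show ?thesis
      using less_enat_imp_finite by (auto simp only: Kunion_def Kset_def)
  qed
  \<comment> \<open>An infinite sample set contains an index beyond \<open>nstar\<close>, which
    supplies the guard; the existential splits over the countably many values of the random
    index.\<close>
  then have "Xsamp r j g s = (\<lambda>\<omega>. infinite (Kunion r j g \<omega>) \<and>
      (\<exists>k. kidx r j g s \<omega> = k \<and> (nstar r j \<omega> < \<infinity> \<and> responds (ev r \<omega>) (cand r j \<omega>) k)))"
    by (auto simp: Xsamp_def fun_eq_iff)
  then show ?thesis
    by (simp only:) measurable
qed

section \<open>The sigma-algebras at selection and along the samples\<close>

lemma Hsig_map_meas:
  "(\<lambda>\<omega>. (nstar r j \<omega> < \<infinity>, nstar r j \<omega>, stopped_prefix r j \<omega>,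
          props r j \<omega>, psistar r j \<omega>, xi r j \<omega>))
     \<in> measurable (Prob r)
       (count_space UNIV \<Otimes>\<^sub>M count_space UNIV \<Otimes>\<^sub>M (\<Pi>\<^sub>M i\<in>UNIV. cemetery event_space) \<Otimes>\<^sub>M
        cemetery (PropM r) \<Otimes>\<^sub>M cemetery (SpecM r) \<Otimes>\<^sub>M cemetery (XiM r j))"
proof (intro measurable_Pair)
  show "stopped_prefix r j \<in> measurable (Prob r) (\<Pi>\<^sub>M i\<in>UNIV. cemetery event_space)"
    unfolding stopped_prefix_def[abs_def]
  proof (rule measurable_PiM_single')
    have ev: "(\<lambda>\<omega>. ev r \<omega> i) \<in> measurable (Prob r) event_space" for i
      using objects by (simp add: measurable_objects_def)
    show *: "(\<lambda>\<omega>. if nstar r j \<omega> < \<infinity> \<and> enat i \<le> nstar r j \<omega> then Some (ev r \<omega> i) else None)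
        \<in> measurable (Prob r) (cemetery event_space)" for i
      by (rule measurable_cemetery[OF _ ev]) measurable
    show "(\<lambda>\<omega> i. if nstar r j \<omega> < \<infinity> \<and> enat i \<le> nstar r j \<omega> then Some (ev r \<omega> i) else None)
        \<in> space (Prob r) \<rightarrow> (\<Pi>\<^sub>E i\<in>UNIV. space (cemetery event_space))"
      using measurable_space[OF *] by auto
  qed
qed (rule nstar_pred nstar_meas props_meas psistar_meas xi_meas)+

lemma space_Hsig [simp]: "space (Hsig r j) = space (Prob r)"
  by (simp add: Hsig_def)

lemma subalgebra_Hsig: "subalgebra (Prob r) (Hsig r j)"
  unfolding subalgebra_def Hsig_def
  using sets_image_in_sets[OF refl Hsig_map_meas[of j]] by simp

lemmas measurable_Hsig = measurable_from_subalg[OF subalgebra_Hsig]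

lemma selected_Hsig: "Measurable.pred (Hsig r j) (\<lambda>\<omega>. nstar r j \<omega> < \<infinity>)"
proof -
  have "(\<lambda>\<omega>. (nstar r j \<omega> < \<infinity>, nstar r j \<omega>, stopped_prefix r j \<omega>,
          props r j \<omega>, psistar r j \<omega>, xi r j \<omega>))
     \<in> measurable (Hsig r j)
       (count_space UNIV \<Otimes>\<^sub>M count_space UNIV \<Otimes>\<^sub>M (\<Pi>\<^sub>M i\<in>UNIV. cemetery event_space) \<Otimes>\<^sub>M
        cemetery (PropM r) \<Otimes>\<^sub>M cemetery (SpecM r) \<Otimes>\<^sub>M cemetery (XiM r j))"
    unfolding Hsig_def
    by (rule measurable_vimage_algebra1) (use measurable_space[OF Hsig_map_meas] in blast)
  from measurable_compose[OF this measurable_fst] show ?thesis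
    by simp
qed

lemma alloc_Hsig: "alloc r g j \<in> borel_measurable (Hsig r j)"
  using allocations[of j] by (simp add: allocations_def)

lemma alloc_meas [measurable]: "alloc r g j \<in> borel_measurable (Prob r)"
  by (rule measurable_Hsig[OF alloc_Hsig])

lemma budget_meas_Prob [measurable]: "budget j \<in> borel_measurable (Prob r)"
  by (rule measurable_Hsig[OF budget_meas])

text \<open>The sigma-algebra on candidates is arbitrary; whether the core group is enabled can
  nevertheless be read off the sign of its allocation.\<close>

lemma enabled_iff_alloc_pos:
  assumes "\<omega> \<in> space (Prob r)" and "nstar r j \<omega> < \<infinity>"
  shows "enabled r j g \<omega> \<longleftrightarrow> 0 < alloc r g j \<omega>"
  using allocations[of j] assms
  by (cases g) (auto simp: allocations_def enabled_def split: if_splits)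

lemma enabled_Hsig: "Measurable.pred (Hsig r j) (\<lambda>\<omega>. nstar r j \<omega> < \<infinity> \<and> enabled r j g \<omega>)"
proof -
  note [measurable] = selected_Hsig alloc_Hsig
  have "Measurable.pred (Hsig r j) (\<lambda>\<omega>. nstar r j \<omega> < \<infinity> \<and> 0 < alloc r g j \<omega>)"
    by measurable
  then show ?thesis
    by (subst measurable_cong) (auto simp: enabled_iff_alloc_pos)
qed

lemma enabled_meas [measurable]:
  "Measurable.pred (Prob r) (\<lambda>\<omega>. nstar r j \<omega> < \<infinity> \<and> enabled r j g \<omega>)"
  by (rule measurable_Hsig[OF enabled_Hsig])

text \<open>The source space \<open>N\<close> is left open: \<open>Prob r\<close> yields that
  \<open>Gsig\<close> is a subalgebra, and the next \<open>Gsig\<close> yields that the family is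
  increasing.\<close>

lemma Gsig_map_meas:
  assumes ident: "(\<lambda>\<omega>. \<omega>) \<in> measurable N (Hsig r j)"
    and samp: "\<And>i. i \<in> {1..s} \<Longrightarrow>
      (\<lambda>\<omega>. (kidx r j g i \<omega>, tau r j g i \<omega>, Xsamp r j g i \<omega>)) \<in> measurable N (count_space UNIV)"
  shows "(\<lambda>\<omega>. (\<omega>, \<lambda>i\<in>{1..s}. (kidx r j g i \<omega>, tau r j g i \<omega>, Xsamp r j g i \<omega>)))
    \<in> measurable N (Hsig r j \<Otimes>\<^sub>M (\<Pi>\<^sub>M i\<in>{1..s}. count_space UNIV))"
  by (intro measurable_Pair measurable_restrict ident samp)

lemma samp_meas: "(\<lambda>\<omega>. (kidx r j g i \<omega>, tau r j g i \<omega>, Xsamp r j g i \<omega>)) \<in> measurable (Prob r) (count_space UNIV)"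
  by measurable

lemma space_Gsig [simp]: "space (Gsig r j g s) = space (Prob r)"
  by (simp add: Gsig_def)

lemma ident_Prob_Hsig: "(\<lambda>\<omega>. \<omega>) \<in> measurable (Prob r) (Hsig r j)"
  using subalgebra_Hsig by (auto simp: measurable_def subalgebra_def)

lemma Gsig_map_Gsig:
  "(\<lambda>\<omega>. (\<omega>, \<lambda>i\<in>{1..s}. (kidx r j g i \<omega>, tau r j g i \<omega>, Xsamp r j g i \<omega>)))
    \<in> measurable (Gsig r j g s) (Hsig r j \<Otimes>\<^sub>M (\<Pi>\<^sub>M i\<in>{1..s}. count_space UNIV))"
  unfolding Gsig_def
  using measurable_space[OF Gsig_map_meas[OF ident_Prob_Hsig samp_meas, where s = s]]
  by (intro measurable_vimage_algebra1) blast

lemma ident_Gsig_Hsig: "(\<lambda>\<omega>. \<omega>) \<in> measurable (Gsig r j g s) (Hsig r j)"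
  using measurable_compose[OF Gsig_map_Gsig measurable_fst] by simp

lemma samp_Gsig:
  assumes "i \<in> {1..s}"
  shows "(\<lambda>\<omega>. (kidx r j g i \<omega>, tau r j g i \<omega>, Xsamp r j g i \<omega>))
    \<in> measurable (Gsig r j g s) (count_space UNIV)"
  using measurable_compose[OF measurable_compose[OF Gsig_map_Gsig measurable_snd]
      measurable_component_singleton[OF assms]] assms
  by simp

lemma subalgebra_Gsig: "subalgebra (Prob r) (Gsig r j g s)"
  unfolding subalgebra_def Gsig_def
  using sets_image_in_sets[OF refl Gsig_map_meas[OF ident_Prob_Hsig samp_meas]] by simp

lemma subalgebra_Gsig_Suc: "subalgebra (Gsig r j g (Suc s)) (Gsig r j g s)"
proof -
  have "sets (Gsig r j g s) \<subseteq> sets (Gsig r j g (Suc s))"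
    unfolding Gsig_def[of r j g s]
    by (rule sets_image_in_sets) (simp, rule Gsig_map_meas[OF ident_Gsig_Hsig samp_Gsig], simp)
  then show ?thesis
    by (simp add: subalgebra_def)
qed

lemma Hsig_Gsig: "f \<in> measurable (Hsig r j) N \<Longrightarrow> f \<in> measurable (Gsig r j g s) N"
  by (rule measurable_compose[OF ident_Gsig_Hsig])

lemma Xsamp_Gsig: "Measurable.pred (Gsig r j g (Suc s)) (Xsamp r j g (Suc s))"
proof -
  have "Suc s \<in> {1..Suc s}"
    by simp
  from measurable_compose[OF samp_Gsig[OF this], where g = "\<lambda>x. snd (snd x)" and L = "count_space UNIV"]
  show ?thesis by simp
qed

section \<open>Measurability of the statistics\<close>

lemma pcond_meas [measurable]: "pcond r j g s \<in> borel_measurable (Prob r)"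
  unfolding pcond_def by simp

lemma pbar_meas [measurable]: "pbar r j g q \<in> borel_measurable (Prob r)"
  unfolding pbar_def[abs_def] by measurable

lemma phat_meas [measurable]: "phat r j g q \<in> borel_measurable (Prob r)"
  unfolding phat_def[abs_def] by measurable

lemma alloc_at_meas [measurable]: "alloc_at r j g q \<in> borel_measurable (Prob r)"
  unfolding alloc_at_def[abs_def] by measurable

lemma Lbound_meas [measurable]: "Lbound r j g m \<in> borel_measurable (Prob r)"
proof -
  \<comment> \<open>The random sample size is separated from the formula; as it takes countably many
    values, measurability for each fixed \<open>q\<close> suffices.\<close>
  have "(\<lambda>\<omega>. (\<lambda>q \<omega>. if q = 0 then 0
      else max 0 (phat r j g q \<omega> - sqrt (ln (1 / alloc_at r j g q \<omega>) / (2 * real q))))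
        (Nsamp r j g m \<omega>) \<omega>) \<in> borel_measurable (Prob r)"
    by (rule measurable_compose_countable[OF _ Nsamp_meas]) measurable
  then show ?thesis
    by (simp add: Lbound_def[abs_def] Let_def)
qed

lemma pbar_Nsamp_meas [measurable]:
  "(\<lambda>\<omega>. pbar r j g (Nsamp r j g m \<omega>) \<omega>) \<in> borel_measurable (Prob r)"
  by (rule measurable_compose_countable[OF _ Nsamp_meas]) measurable

section \<open>Certification and failure events\<close>

text \<open>The candidate's threshold is known to be measurable only where a candidate is selected;
  the default 0 elsewhere makes this version measurable on the whole space.\<close>

definition guarded_threshold :: "nat \<Rightarrow> group \<Rightarrow> 'w \<Rightarrow> real" where
  "guarded_threshold j g \<omega> =
     (case g of All \<Rightarrow> (if nstar r j \<omega> < \<infinity> then thr (cand r j \<omega>) else 0) | Core \<Rightarrow> lam_core r)"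

lemma guarded_threshold_meas [measurable]: "guarded_threshold j g \<in> borel_measurable (Prob r)"
  unfolding guarded_threshold_def[abs_def]
  by (cases g) (simp_all only: group.case thr_meas borel_measurable_const)

lemma guarded_threshold_eq: "nstar r j \<omega> < \<infinity> \<Longrightarrow> guarded_threshold j g \<omega> = threshold r j g \<omega>"
  by (simp add: guarded_threshold_def threshold_def split: group.split)

text \<open>The condition inside \<open>mcert\<close>, isolated so that activation and the first
  certifying index are expressed by a sequence of measurable predicates.\<close>

definition certifies :: "nat \<Rightarrow> nat \<Rightarrow> 'w \<Rightarrow> bool" where
  "certifies j m \<omega> \<longleftrightarrow> nstar r j \<omega> < enat m \<and>
     (\<forall>g. enabled r j g \<omega> \<longrightarrow> Nsamp r j g m \<omega> > 0 \<and> Lbound r j g m \<omega> \<ge> threshold r j g \<omega>)"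

lemma certifies_selected: "certifies j m \<omega> \<Longrightarrow> nstar r j \<omega> < \<infinity>"
  unfolding certifies_def by (blast intro: less_enat_imp_finite)

lemma certifies_meas [measurable]: "Measurable.pred (Prob r) (certifies j m)"
proof -
  have "certifies j m \<omega> \<longleftrightarrow> nstar r j \<omega> < enat m \<and>
     (\<forall>g\<in>{All, Core}. nstar r j \<omega> < \<infinity> \<and> enabled r j g \<omega> \<longrightarrow>
        Nsamp r j g m \<omega> > 0 \<and> Lbound r j g m \<omega> \<ge> guarded_threshold j g \<omega>)" for \<omega>
  proof (cases "nstar r j \<omega> < enat m")
    case True
    then have "nstar r j \<omega> < \<infinity>"
      by (rule less_enat_imp_finite)
    with True show ?thesis
      by (auto simp: certifies_def guarded_threshold_eq) (metis group.exhaust)+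
  qed (simp add: certifies_def)
  then have "certifies j m = (\<lambda>\<omega>. nstar r j \<omega> < enat m \<and>
     (\<forall>g\<in>{All, Core}. nstar r j \<omega> < \<infinity> \<and> enabled r j g \<omega> \<longrightarrow>
        Nsamp r j g m \<omega> > 0 \<and> Lbound r j g m \<omega> \<ge> guarded_threshold j g \<omega>))"
    by (intro ext)
  then show ?thesis
    by (simp only:) measurable
qed

lemma mcert_eq:
  assumes "certifies j m \<omega>" and "\<And>m'. m' < m \<Longrightarrow> \<not> certifies j m' \<omega>"
  shows "mcert r j \<omega> = enat m"
  unfolding mcert_def certifies_def[symmetric]
proof (rule cInf_eq_minimum)
  show "enat m \<in> enat ` {m. certifies j m \<omega>}"
    using assms(1) by blast
  show "enat m \<le> x" if "x \<in> enat ` {m. certifies j m \<omega>}" for x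
    using that assms(2) by (auto simp flip: not_less)
qed

lemma activated_iff: "activated r j \<omega> \<longleftrightarrow> (\<exists>m. certifies j m \<omega>)"
proof
  show "\<exists>m. certifies j m \<omega>" if "activated r j \<omega>"
  proof (rule ccontr)
    assume "\<nexists>m. certifies j m \<omega>"
    \<comment> \<open>In \<open>enat\<close> the infimum of the empty set is
      \<open>\<infinity>\<close>, which encodes absence of certification.\<close>
    then have "mcert r j \<omega> = Inf {}"
      unfolding mcert_def certifies_def[symmetric] by simp
    with that show False
      by (simp add: activated_def top_enat_def)
  qed
  show "activated r j \<omega>" if "\<exists>m. certifies j m \<omega>"
  proof -
    have "mcert r j \<omega> = enat (LEAST m. certifies j m \<omega>)"
      by (rule mcert_eq) (use LeastI_ex[OF that] not_less_Least in auto)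
    then show ?thesis
      by (simp add: activated_def)
  qed
qed

text \<open>Splitting over the value \<open>m\<close> of the first certifying index removes the
  random index from the event, which gives measurability and, in the error bound, direct access to
  the certification inequality at \<open>m\<close>.\<close>

lemma Fail_group_eq:
  "Fail_group r j g = {\<omega> \<in> space (Prob r). \<exists>m. certifies j m \<omega> \<and> (\<forall>m'<m. \<not> certifies j m' \<omega>) \<and>
     (nstar r j \<omega> < \<infinity> \<and> enabled r j g \<omega>) \<and>
     pbar r j g (Nsamp r j g m \<omega>) \<omega> < guarded_threshold j g \<omega>}"
proof -
  have "(activated r j \<omega> \<and> enabled r j g \<omega> \<and>
        pbar r j g (Nsamp r j g (the_enat (vstart r (Suc j) \<omega>) - 1) \<omega>) \<omega> < threshold r j g \<omega>) \<longleftrightarrow>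
    (\<exists>m. certifies j m \<omega> \<and> (\<forall>m'<m. \<not> certifies j m' \<omega>) \<and>
     (nstar r j \<omega> < \<infinity> \<and> enabled r j g \<omega>) \<and>
     pbar r j g (Nsamp r j g m \<omega>) \<omega> < guarded_threshold j g \<omega>)" (is "?L \<longleftrightarrow> (\<exists>m. ?R m)") for \<omega>
  proof (cases "\<exists>m. certifies j m \<omega>")
    case True
    define m where "m = (LEAST m. certifies j m \<omega>)"
    have m: "certifies j m \<omega>" "\<And>m'. m' < m \<Longrightarrow> \<not> certifies j m' \<omega>"
      unfolding m_def using LeastI_ex[OF True] by (auto dest: not_less_Least)
    have act: "activated r j \<omega>"
      using True by (simp add: activated_iff)
    \<comment> \<open>The next version starts one index after certification, so subtracting 1
      recovers the certifying index.\<close>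
    have "the_enat (vstart r (Suc j) \<omega>) - 1 = m"
      using act mcert_eq[OF m] by (simp add: one_enat_def)
    moreover have "(\<exists>m. ?R m) \<longleftrightarrow> ?R m"
      using m by (metis linorder_neqE_nat)
    ultimately show ?thesis
      using m act certifies_selected[OF m(1)] by (simp add: guarded_threshold_eq)
  qed (simp add: activated_iff)
  then show ?thesis
    unfolding Fail_group_def by simp
qed

lemma Fail_group_sets [measurable]: "Fail_group r j g \<in> sets (Prob r)"
  unfolding Fail_group_eq by measurable

lemma Fail_sets [measurable]: "Fail r j \<in> sets (Prob r)"
  unfolding Fail_def by measurable

section \<open>Error bounds per sample size, group and version\<close>

lemma alloc_bounds:
  assumes "\<omega> \<in> space (Prob r)" and "nstar r j \<omega> < \<infinity> \<and> enabled r j g \<omega>"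
  shows "0 < alloc r g j \<omega>" and "alloc r g j \<omega> < 1"
proof -
  have sum: "alloc r All j \<omega> + alloc r Core j \<omega> \<le> budget j \<omega>" "0 < alloc r All j \<omega>" "0 \<le> alloc r Core j \<omega>"
    using allocations[of j] assms by (auto simp: allocations_def split: if_splits)
  show "0 < alloc r g j \<omega>"
    using enabled_iff_alloc_pos assms by blast
  show "alloc r g j \<omega> < 1"
    using sum budget[OF assms(1), of j] by (cases g) auto
qed

text \<open>These are the bounds on the level \<open>D\<close> in \<open>adaptive_hoeffding\<close>:
  the allocation is below 1, and \<open>6 \<le> pi\<^sup>2\<close> because
  \<open>pi > 3\<close>.\<close>

lemma alloc_at_bounds:
  assumes "\<omega> \<in> space (Prob r)" and "nstar r j \<omega> < \<infinity> \<and> enabled r j g \<omega>" and "0 < q"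
  shows "0 < alloc_at r j g q \<omega> \<and> alloc_at r j g q \<omega> \<le> 1"
proof -
  have "6 \<le> pi\<^sup>2"
    using power_mono[of 3 pi 2] pi_gt3 by simp
  moreover have "1 \<le> (real q)\<^sup>2"
    using assms(3) by (simp add: one_le_power)
  ultimately have "6 * 1 \<le> pi\<^sup>2 * (real q)\<^sup>2"
    by (intro mult_mono) auto
  then show ?thesis
    using alloc_bounds[OF assms(1,2)] assms(3) by (simp add: alloc_at_def divide_le_eq)
qed

text \<open>Failure of the lower confidence bound at a deterministic sample size, before its
  truncation at 0.\<close>

definition deviation :: "nat \<Rightarrow> group \<Rightarrow> nat \<Rightarrow> 'w set" where
  "deviation j g q = {\<omega> \<in> space (Prob r). (nstar r j \<omega> < \<infinity> \<and> enabled r j g \<omega>) \<and>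
     pbar r j g q \<omega> < phat r j g q \<omega> - sqrt (ln (1 / alloc_at r j g q \<omega>) / (2 * real q))}"

lemma deviation_sets [measurable]: "deviation j g q \<in> sets (Prob r)"
  unfolding deviation_def by measurable

lemma emeasure_deviation_le:
  assumes "0 < q"
  shows "emeasure (Prob r) (deviation j g q)
    \<le> (\<integral>\<^sup>+\<omega>. (if nstar r j \<omega> < \<infinity> \<and> enabled r j g \<omega> then ennreal (alloc_at r j g q \<omega>) else 0) \<partial>Prob r)"
proof -
  have "alloc_at r j g q \<in> borel_measurable (Gsig r j g 0)"
    unfolding alloc_at_def[abs_def] using Hsig_Gsig[OF alloc_Hsig] by measurable
  from adaptive_hoeffding[OF subalgebra_Gsig subalgebra_Gsig_Suc Xsamp_Gsig Hsig_Gsig[OF enabled_Hsig]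
      this alloc_at_bounds assms]
  show ?thesis
    using assms by (simp add: deviation_def pbar_def phat_def pcond_def)
qed

text \<open>Used to undo the truncation in \<open>Lbound\<close>: a nonnegative average lying below
  the truncated bound lies below the untruncated one.\<close>

lemma AE_pcond_nonneg: "AE \<omega> in Prob r. \<forall>s. 0 \<le> pcond r j g s \<omega>"
  unfolding AE_all_countable
proof
  fix s
  interpret finite_measure_subalgebra "Prob r" "Gsig r j g (s - 1)"
    by unfold_locales (rule subalgebra_Gsig)
  show "AE \<omega> in Prob r. 0 \<le> pcond r j g s \<omega>"
    unfolding pcond_def by (rule real_cond_exp_pos) auto
qed

text \<open>Euler's sum of the inverse squares, \<open>pi\<^sup>2 / 6\<close>, cancels the
  normalising factor; the shift \<open>Suc n\<close> starts the sample sizes at 1.\<close>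

lemma suminf_alloc_at:
  assumes "0 \<le> alloc r g j \<omega>"
  shows "(\<Sum>n. ennreal (alloc_at r j g (Suc n) \<omega>)) = ennreal (alloc r g j \<omega>)"
proof (rule suminf_ennreal_eq)
  show "0 \<le> alloc_at r j g (Suc n) \<omega>" for n
    using assms by (simp add: alloc_at_def)
  show "(\<lambda>n. alloc_at r j g (Suc n) \<omega>) sums alloc r g j \<omega>"
    using sums_mult[OF inverse_squares_sums, of "6 * alloc r g j \<omega> / pi\<^sup>2"]
    by (simp add: alloc_at_def add.commute)
qed

text \<open>At certification the threshold is at most \<open>Lbound\<close>, so a failure puts the
  average \<open>pbar\<close> below \<open>Lbound\<close> and lies in the deviation event of the
  sample size reached. A union over all sizes covers this random size.\<close>

lemma emeasure_Fail_group_le: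
  "emeasure (Prob r) (Fail_group r j g)
    \<le> (\<integral>\<^sup>+\<omega>. (if nstar r j \<omega> < \<infinity> \<and> enabled r j g \<omega> then ennreal (alloc r g j \<omega>) else 0) \<partial>Prob r)"
proof -
  have "emeasure (Prob r) (Fail_group r j g) \<le> emeasure (Prob r) (\<Union>n. deviation j g (Suc n))"
  proof (rule emeasure_mono_AE)
    show "AE \<omega> in Prob r. \<omega> \<in> Fail_group r j g \<longrightarrow> \<omega> \<in> (\<Union>n. deviation j g (Suc n))"
      using AE_pcond_nonneg[of j g]
    proof eventually_elim
      case (elim \<omega>)
      show ?case
      proof
        assume "\<omega> \<in> Fail_group r j g"
        then obtain m where \<omega>: "\<omega> \<in> space (Prob r)" "certifies j m \<omega>" "nstar r j \<omega> < \<infinity>" "enabled r j g \<omega>"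
            "pbar r j g (Nsamp r j g m \<omega>) \<omega> < threshold r j g \<omega>"
          by (auto simp: Fail_group_eq guarded_threshold_eq)
        define q where "q = Nsamp r j g m \<omega>"
        have q: "0 < q" "threshold r j g \<omega> \<le> Lbound r j g m \<omega>"
          using \<omega> by (auto simp: certifies_def q_def)
        have "0 \<le> pbar r j g q \<omega>"
          unfolding pbar_def using elim by (intro mult_nonneg_nonneg sum_nonneg) auto
        moreover have "pbar r j g q \<omega> < Lbound r j g m \<omega>"
          using \<omega>(5) q(2) by (simp add: q_def)
        ultimately have "pbar r j g q \<omega>
            < phat r j g q \<omega> - sqrt (ln (1 / alloc_at r j g q \<omega>) / (2 * real q))"
          using q(1) by (simp add: Lbound_def q_def[symmetric] max_def split: if_splits)
        then have "\<omega> \<in> deviation j g (Suc (q - 1))"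
          using \<omega> q(1) by (simp add: deviation_def)
        then show "\<omega> \<in> (\<Union>n. deviation j g (Suc n))"
          by blast
      qed
    qed
  qed measurable
  also have "\<dots> \<le> (\<Sum>n. emeasure (Prob r) (deviation j g (Suc n)))"
    by (rule emeasure_subadditive_countably) auto
  also have "\<dots> \<le> (\<Sum>n. \<integral>\<^sup>+\<omega>. (if nstar r j \<omega> < \<infinity> \<and> enabled r j g \<omega>
      then ennreal (alloc_at r j g (Suc n) \<omega>) else 0) \<partial>Prob r)"
    by (intro suminf_le emeasure_deviation_le) auto
  \<comment> \<open>The allocation may be random, so the series over sample sizes is evaluated
    pointwise under the integral.\<close>
  also have "\<dots> = (\<integral>\<^sup>+\<omega>. (\<Sum>n. if nstar r j \<omega> < \<infinity> \<and> enabled r j g \<omega>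
      then ennreal (alloc_at r j g (Suc n) \<omega>) else 0) \<partial>Prob r)"
    by (rule nn_integral_suminf[symmetric]) measurable
  also have "\<dots> = (\<integral>\<^sup>+\<omega>. (if nstar r j \<omega> < \<infinity> \<and> enabled r j g \<omega> then ennreal (alloc r g j \<omega>) else 0) \<partial>Prob r)"
    by (rule nn_integral_cong) (auto simp: suminf_alloc_at less_imp_le[OF alloc_bounds(1)])
  finally show ?thesis .
qed

lemma emeasure_Fail_le: "emeasure (Prob r) (Fail r j) \<le> (\<integral>\<^sup>+\<omega>. ennreal (budget j \<omega>) \<partial>Prob r)"
proof -
  let ?a = "\<lambda>g \<omega>. if nstar r j \<omega> < \<infinity> \<and> enabled r j g \<omega> then ennreal (alloc r g j \<omega>) else 0"
  have "emeasure (Prob r) (Fail r j)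
      \<le> emeasure (Prob r) (Fail_group r j All) + emeasure (Prob r) (Fail_group r j Core)"
    unfolding Fail_def by (rule emeasure_subadditive) auto
  also have "\<dots> \<le> (\<integral>\<^sup>+\<omega>. ?a All \<omega> \<partial>Prob r) + (\<integral>\<^sup>+\<omega>. ?a Core \<omega> \<partial>Prob r)"
    by (intro add_mono emeasure_Fail_group_le)
  also have "\<dots> = (\<integral>\<^sup>+\<omega>. ?a All \<omega> + ?a Core \<omega> \<partial>Prob r)"
    by (rule nn_integral_add[symmetric]) measurable
  also have "\<dots> \<le> (\<integral>\<^sup>+\<omega>. ennreal (budget j \<omega>) \<partial>Prob r)"
  proof (rule nn_integral_mono)
    fix \<omega> assume \<omega>: "\<omega> \<in> space (Prob r)"
    \<comment> \<open>Pointwise, the groups share one budget; a group that is not enabled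
      contributes 0, and without selection both terms vanish.\<close>
    show "?a All \<omega> + ?a Core \<omega> \<le> ennreal (budget j \<omega>)"
    proof (cases "nstar r j \<omega> < \<infinity>")
      case True
      then have "alloc r All j \<omega> + alloc r Core j \<omega> \<le> budget j \<omega>" "0 < alloc r All j \<omega>" "0 \<le> alloc r Core j \<omega>"
        using allocations[of j] \<omega> by (auto simp: allocations_def split: if_splits)
      moreover from this have "?a All \<omega> + ?a Core \<omega> \<le> ennreal (alloc r All j \<omega> + alloc r Core j \<omega>)"
        by (auto simp: ennreal_plus)
      ultimately show ?thesis
        by (meson ennreal_leI order_trans)
    qed simp
  qed
  finally show ?thesis .
qed

text \<open>The union bound allows arbitrary dependence between versions. Only the pathwise sum of
  the budgets is bounded, so sum and integral are interchanged before \<open>\<delta>\<close>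
  enters.\<close>

lemma measure_UN_Fail_le:
  assumes "0 < \<delta>"
    and "AE \<omega> in Prob r. summable (\<lambda>j. budget j \<omega>) \<and> (\<Sum>j. budget j \<omega>) \<le> \<delta>"
  shows "measure (Prob r) (\<Union>j. Fail r j) \<le> \<delta>"
proof -
  have "emeasure (Prob r) (\<Union>j. Fail r j) \<le> (\<Sum>j. emeasure (Prob r) (Fail r j))"
    by (rule emeasure_subadditive_countably) auto
  also have "\<dots> \<le> (\<Sum>j. \<integral>\<^sup>+\<omega>. ennreal (budget j \<omega>) \<partial>Prob r)"
    by (intro suminf_le emeasure_Fail_le) auto
  also have "\<dots> = (\<integral>\<^sup>+\<omega>. (\<Sum>j. ennreal (budget j \<omega>)) \<partial>Prob r)"
    by (rule nn_integral_suminf[symmetric]) measurable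
  also have "\<dots> \<le> (\<integral>\<^sup>+\<omega>. ennreal \<delta> \<partial>Prob r)"
  proof (rule nn_integral_mono_AE)
    show "AE \<omega> in Prob r. (\<Sum>j. ennreal (budget j \<omega>)) \<le> ennreal \<delta>"
      using assms(2) AE_space
    proof eventually_elim
      case (elim \<omega>)
      \<comment> \<open>Summability is essential here: a real \<open>suminf\<close> bounds the
        extended one only when the series converges.\<close>
      then have "(\<Sum>j. ennreal (budget j \<omega>)) = ennreal (\<Sum>j. budget j \<omega>)"
        using budget by (intro suminf_ennreal2) (auto intro: less_imp_le)
      with elim show ?case
        by (simp add: ennreal_leI)
    qed
  qed
  also have "\<dots> = ennreal \<delta>"
    by (simp add: emeasure_space_1)
  finally show ?thesis
    using assms(1) by (simp add: emeasure_eq_measure)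
qed

end

theorem theorem3:
  fixes r :: "('w, 'ap :: finite, 'x) run"
    and \<delta>s :: "nat \<Rightarrow> 'w \<Rightarrow> real" and \<delta> :: real
  assumes "prob_space (Prob r)"
    and "design r"
    and "\<And>\<omega>. \<omega> \<in> space (Prob r) \<Longrightarrow> timed_stream (ev r \<omega>)"
    and "measurable_objects r"
    and "selection r"
    and "\<And>j. recurrence r j"
    and "\<And>j. allocations r j (\<delta>s j)"
    and "\<And>j. \<delta>s j \<in> borel_measurable (Hsig r j)"
    and "\<And>j \<omega>. \<omega> \<in> space (Prob r) \<Longrightarrow> 0 < \<delta>s j \<omega> \<and> \<delta>s j \<omega> < 1"
    and "0 < \<delta>" and "\<delta> < 1"
    and "AE \<omega> in Prob r. summable (\<lambda>j. \<delta>s j \<omega>) \<and> (\<Sum>j. \<delta>s j \<omega>) \<le> \<delta>"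
  shows "(\<Union>j. Fail r j) \<in> sets (Prob r) \<and> measure (Prob r) (\<Union>j. Fail r j) \<le> \<delta>"
proof -
  interpret certified_run r \<delta>s
    by (rule certified_run.intro[OF assms(1-5) assms(7-9)])
  show ?thesis
    using measure_UN_Fail_le[OF assms(10,12)] by auto
qed

end
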